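(* Let $\mathcal{I}$ be a proper ideal on a set $X$. Then $\mathcal{I}$ is a maximal ideal if and only if for all $A,B\subseteq X$, if $A\cap B\in\mathcal{I}$ then $A\in\mathcal{I}$ or $B\in\mathcal{I}$.
   Context: An ideal on a set $X$ is a non-empty family $\mathcal{I}\subseteq 2^X$ ($2^X$ is the power set of $X$) such that (i) $A\in\mathcal{I}$ and $B\subseteq A$ imply $B\in\mathcal{I}$, and (ii) $A,B\in\mathcal{I}$ imply $A\cup B\in\mathcal{I}$. An ideal $\mathcal{I}$ is proper if $\mathcal{I}\neq 2^X$. A proper ideal $\mathcal{I}$ on $X$ is a maximal ideal if for every ideal $\mathcal{J}$ on $X$ with $\mathcal{I}\subseteq\mathcal{J}$, one has $\mathcal{I}=\mathcal{J}$ or $\mathcal{J}=2^X$. *)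

theory Defs
  imports Main
begin

definition set_ideal :: "'a set \<Rightarrow> 'a set set \<Rightarrow> bool" where
  "set_ideal X \<I> \<longleftrightarrow>
     \<I> \<noteq> {} \<and> \<I> \<subseteq> Pow X \<and>
     (\<forall>A B. A \<in> \<I> \<longrightarrow> B \<subseteq> A \<longrightarrow> B \<in> \<I>) \<and>
     (\<forall>A B. A \<in> \<I> \<longrightarrow> B \<in> \<I> \<longrightarrow> A \<union> B \<in> \<I>)"

definition proper_set_ideal :: "'a set \<Rightarrow> 'a set set \<Rightarrow> bool" where
  "proper_set_ideal X \<I> \<longleftrightarrow> set_ideal X \<I> \<and> \<I> \<noteq> Pow X"

definition maximal_set_ideal :: "'a set \<Rightarrow> 'a set set \<Rightarrow> bool" where
  "maximal_set_ideal X \<I> \<longleftrightarrow>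
     proper_set_ideal X \<I> \<and>
     (\<forall>\<J>. set_ideal X \<J> \<longrightarrow> \<I> \<subseteq> \<J> \<longrightarrow> \<I> = \<J> \<or> \<J> = Pow X)"

end

theory Submission
  imports Defs
begin

text \<open>
  The set \<open>A\<close> and the ideal \<open>\<I>\<close> generate an ideal, whose members are the sets covered by \<open>A\<close> up to
  a set in \<open>\<I>\<close>. If \<open>\<I>\<close> is maximal and \<open>A \<notin> \<I>\<close>, this ideal contains \<open>X\<close>, so all of \<open>X\<close> outside
  \<open>A\<close> is negligible. A set \<open>B\<close> with \<open>A \<inter> B \<in> \<I>\<close> is then negligible both inside and outside \<open>A\<close>.
  Conversely, \<open>A \<inter> (X - A) = {}\<close> is always in \<open>\<I>\<close>, so the primality condition puts \<open>A\<close> or its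
  complement into \<open>\<I>\<close>. A larger ideal therefore contains some set together with its complement,
  hence contains \<open>X\<close>.
\<close>

definition ideal_adjoin :: "'a set \<Rightarrow> 'a set set \<Rightarrow> 'a set set" where
  "ideal_adjoin A \<I> = {C. \<exists>S\<in>\<I>. C \<subseteq> A \<union> S}"

lemma set_ideal_subset: "set_ideal X \<I> \<Longrightarrow> A \<in> \<I> \<Longrightarrow> B \<subseteq> A \<Longrightarrow> B \<in> \<I>"
  unfolding set_ideal_def by blast

lemma set_ideal_Un: "set_ideal X \<I> \<Longrightarrow> A \<in> \<I> \<Longrightarrow> B \<in> \<I> \<Longrightarrow> A \<union> B \<in> \<I>"
  unfolding set_ideal_def by blast

lemma set_ideal_Pow: "set_ideal X \<I> \<Longrightarrow> A \<in> \<I> \<Longrightarrow> A \<subseteq> X"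
  unfolding set_ideal_def by blast

lemma set_ideal_empty: "set_ideal X \<I> \<Longrightarrow> {} \<in> \<I>"
  using set_ideal_subset[of X \<I> _ "{}"] unfolding set_ideal_def by auto

lemma set_ideal_eq_Pow_iff:
  assumes "set_ideal X \<I>"
  shows "\<I> = Pow X \<longleftrightarrow> X \<in> \<I>"
  using set_ideal_subset[OF assms, of X] set_ideal_Pow[OF assms] by auto

lemma set_ideal_ideal_adjoin:
  assumes ideal: "set_ideal X \<I>" and "A \<subseteq> X"
  shows "set_ideal X (ideal_adjoin A \<I>)"
  unfolding set_ideal_def
proof (intro conjI allI impI)
  show "ideal_adjoin A \<I> \<noteq> {}"
    using set_ideal_empty[OF ideal] unfolding ideal_adjoin_def by blast
  show "ideal_adjoin A \<I> \<subseteq> Pow X"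
    using \<open>A \<subseteq> X\<close> set_ideal_Pow[OF ideal] unfolding ideal_adjoin_def by blast
  show "D \<in> ideal_adjoin A \<I>" if "C \<in> ideal_adjoin A \<I>" "D \<subseteq> C" for C D
    using that unfolding ideal_adjoin_def by blast
  show "C \<union> D \<in> ideal_adjoin A \<I>" if "C \<in> ideal_adjoin A \<I>" "D \<in> ideal_adjoin A \<I>" for C D
  proof -
    from that obtain S T where "S \<in> \<I>" "T \<in> \<I>" "C \<subseteq> A \<union> S" "D \<subseteq> A \<union> T"
      unfolding ideal_adjoin_def by blast
    moreover from this have "S \<union> T \<in> \<I>"
      by (intro set_ideal_Un[OF ideal])
    moreover have "C \<union> D \<subseteq> A \<union> (S \<union> T)"
      using calculation by blast
    ultimately show ?thesis
      unfolding ideal_adjoin_def by blast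
  qed
qed

text \<open>Otherwise adjoining \<open>A\<close> would give an ideal strictly between \<open>\<I>\<close> and the power set.\<close>

lemma maximal_set_ideal_Diff:
  assumes max: "maximal_set_ideal X \<I>" and "A \<subseteq> X" "A \<notin> \<I>"
  shows "X - A \<in> \<I>"
proof -
  have ideal: "set_ideal X \<I>"
    using max unfolding maximal_set_ideal_def proper_set_ideal_def by blast
  have "\<I> \<subseteq> ideal_adjoin A \<I>" "A \<in> ideal_adjoin A \<I>"
    using set_ideal_empty[OF ideal] unfolding ideal_adjoin_def by blast+
  then have "ideal_adjoin A \<I> = Pow X"
    using max \<open>A \<notin> \<I>\<close> set_ideal_ideal_adjoin[OF ideal \<open>A \<subseteq> X\<close>]
    unfolding maximal_set_ideal_def by blast
  then obtain S where "S \<in> \<I>" "X \<subseteq> A \<union> S"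
    unfolding ideal_adjoin_def by blast
  then show ?thesis
    using set_ideal_subset[OF ideal, of S "X - A"] by blast
qed

theorem theorem3p2:
  fixes X :: "'a set" and \<I> :: "'a set set"
  assumes "proper_set_ideal X \<I>"
  shows "maximal_set_ideal X \<I> \<longleftrightarrow>
    (\<forall>A B. A \<subseteq> X \<longrightarrow> B \<subseteq> X \<longrightarrow> A \<inter> B \<in> \<I> \<longrightarrow> A \<in> \<I> \<or> B \<in> \<I>)"
proof
  have ideal: "set_ideal X \<I>"
    using assms unfolding proper_set_ideal_def by blast
  show "\<forall>A B. A \<subseteq> X \<longrightarrow> B \<subseteq> X \<longrightarrow> A \<inter> B \<in> \<I> \<longrightarrow> A \<in> \<I> \<or> B \<in> \<I>"
    if max: "maximal_set_ideal X \<I>"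
  proof (intro allI impI)
    fix A B assume "A \<subseteq> X" "B \<subseteq> X" "A \<inter> B \<in> \<I>"
    show "A \<in> \<I> \<or> B \<in> \<I>"
    proof (cases "A \<in> \<I>")
      case False
      then have "(A \<inter> B) \<union> (X - A) \<in> \<I>"
        by (intro set_ideal_Un[OF ideal] maximal_set_ideal_Diff[OF max] \<open>A \<inter> B \<in> \<I>\<close> \<open>A \<subseteq> X\<close>)
      moreover have "B \<subseteq> (A \<inter> B) \<union> (X - A)"
        using \<open>B \<subseteq> X\<close> by blast
      ultimately show ?thesis
        using set_ideal_subset[OF ideal] by iprover
    qed blast
  qed
  show "maximal_set_ideal X \<I>"
    if prime: "\<forall>A B. A \<subseteq> X \<longrightarrow> B \<subseteq> X \<longrightarrow> A \<inter> B \<in> \<I> \<longrightarrow> A \<in> \<I> \<or> B \<in> \<I>"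
    unfolding maximal_set_ideal_def
  proof (intro conjI allI impI)
    fix \<J> assume J: "set_ideal X \<J>" and "\<I> \<subseteq> \<J>"
    show "\<I> = \<J> \<or> \<J> = Pow X"
    proof (cases "\<I> = \<J>")
      case False
      then obtain A where "A \<in> \<J>" "A \<notin> \<I>"
        using \<open>\<I> \<subseteq> \<J>\<close> by blast
      then have "A \<subseteq> X"
        using set_ideal_Pow[OF J] by iprover
      have "A \<inter> (X - A) \<in> \<I>"
        using set_ideal_empty[OF ideal] by simp
      then have "X - A \<in> \<I>"
        using prime \<open>A \<subseteq> X\<close> \<open>A \<notin> \<I>\<close> by blast
      then have "A \<union> (X - A) \<in> \<J>"
        using \<open>\<I> \<subseteq> \<J>\<close> by (intro set_ideal_Un[OF J] \<open>A \<in> \<J>\<close>) blast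
      moreover have "A \<union> (X - A) = X"
        using \<open>A \<subseteq> X\<close> by blast
      ultimately show ?thesis
        using set_ideal_eq_Pow_iff[OF J] by simp
    qed blast
  qed (rule assms)
qed

end
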